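(* Suppose $\phi_1,\dots,\phi_r$ are $r$ Koopman eigenfunctions of the system $\boldsymbol{\upsilon}^+=\Gamma(\boldsymbol{\upsilon})$ with pairwise distinct eigenvalues $\lambda_1,\dots,\lambda_r$. Let the initial condition $\boldsymbol{\upsilon}_1$ be spectrally informative about these eigenfunctions, i.e. $\phi_i(\boldsymbol{\upsilon}_1)\ne0$ for all $i$. Assume that $1\notin\{\lambda_1,\dots,\lambda_r\}$ and that $2\le n\le r$. Then there exists an (explicitly constructible) dictionary $\boldsymbol{\psi}$ such that the resulting matrix $\mathbf{X}_{\rm ms}$ does not have full column rank and yet mean-subtracted DMD is equivalent to temporal DFT.
   Context: Setting: $\Gamma:\mathbb{R}^p\to\mathbb{R}^p$ is a map. $\mathcal{H}$ is a vector space of complex-valued functions on $\mathbb{R}^p$ closed under composition with $\Gamma$; the Koopman operator is $U:\mathcal{H}\to\mathcal{H}$, $U\psi=\psi\circ\Gamma$; a Koopman eigenfunction with eigenvalue $\lambda$ is $\phi\in\mathcal{H}$ with $U\phi=\lambda\phi$. A dictionary is a column vector $\boldsymbol{\psi}=[\psi_i]_{i=1}^m$ of finitely many observables $\psi_i\in\mathcal{H}$. Data and mean-subtracted DMD: for the dictionary $\boldsymbol{\psi}$, $\mathbf{z}_j=\boldsymbol{\psi}(\Gamma^{j-1}(\boldsymbol{\upsilon}_1))$, $j=1,\dots,n+1$; $\boldsymbol{\mu}=\frac{1}{n+1}\sum_{j=1}^{n+1}\mathbf{z}_j$; $\mathbf{X}_{\rm ms}=[\mathbf{z}_j-\boldsymbol{\mu}]_{j=1}^n\in\mathbb{C}^{m\times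 n}$; $\mathbf{c}^*=\mathbf{X}_{\rm ms}^{\dagger}(\mathbf{z}_{n+1}-\boldsymbol{\mu})$ with $\dagger$ the Moore-Penrose pseudo-inverse. The mean-subtracted DMD eigenvalues $\{\tilde\lambda_i\}_{i=1}^n$ are the eigenvalues of the $n\times n$ companion matrix with $1$'s on the first sub-diagonal, last column $\mathbf{c}^*$, and zeros elsewhere. Mean-subtracted DMD is equivalent to (temporal) DFT when $\{\tilde\lambda_i\}_{i=1}^n=\{z\in\mathbb{C}: z\ne1,\ z^{n+1}=1\}$. *)

theory Defs
  imports
    "HOL-Analysis.Finite_Cartesian_Product"
    "Jordan_Normal_Form.Spectral_Radius"
    "Jordan_Normal_Form.Schur_Decomposition"
    "Jordan_Normal_Form.DL_Rank"
begin

(* From here on, vec, $ and the other vector notations are those of Jordan_Normal_Form; the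
   state space R^p is the Cartesian power real ^ 'p. *)
unbundle no vec_syntax

hide_const (open) Finite_Cartesian_Product.vec Finite_Cartesian_Product.mat
  Finite_Cartesian_Product.row Finite_Cartesian_Product.rows
  Finite_Cartesian_Product.transpose
hide_type (open) Finite_Cartesian_Product.vec

definition complex_function_space :: "('s \<Rightarrow> complex) set \<Rightarrow> bool" where
  "complex_function_space H \<longleftrightarrow>
     (\<lambda>x. 0) \<in> H \<and>
     (\<forall>f\<in>H. \<forall>g\<in>H. (\<lambda>x. f x + g x) \<in> H) \<and>
     (\<forall>c. \<forall>f\<in>H. (\<lambda>x. c * f x) \<in> H)"

definition koopman :: "('s \<Rightarrow> 's) \<Rightarrow> ('s \<Rightarrow> complex) \<Rightarrow> 's \<Rightarrow> complex" where
  "koopman \<Gamma> \<psi> = \<psi> \<circ> \<Gamma>"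

definition observable_space :: "('s \<Rightarrow> 's) \<Rightarrow> ('s \<Rightarrow> complex) set \<Rightarrow> bool" where
  "observable_space \<Gamma> H \<longleftrightarrow> complex_function_space H \<and> (\<forall>\<psi>\<in>H. koopman \<Gamma> \<psi> \<in> H)"

(* The zero function is not excluded here; a function that does not vanish at the initial
   condition is in any case nonzero. *)
definition koopman_eigenfunction ::
    "('s \<Rightarrow> 's) \<Rightarrow> ('s \<Rightarrow> complex) set \<Rightarrow> complex \<Rightarrow> ('s \<Rightarrow> complex) \<Rightarrow> bool" where
  "koopman_eigenfunction \<Gamma> H l \<phi> \<longleftrightarrow> \<phi> \<in> H \<and> koopman \<Gamma> \<phi> = (\<lambda>x. l * \<phi> x)"

definition dictionary :: "('s \<Rightarrow> complex) set \<Rightarrow> ('s \<Rightarrow> complex) list \<Rightarrow> bool" where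
  "dictionary H \<psi>s \<longleftrightarrow> \<psi>s \<noteq> [] \<and> set \<psi>s \<subseteq> H"

(* Snapshots are numbered from 1, as in z_j = psi (Gamma^(j-1) v). *)
definition snapshot ::
    "('s \<Rightarrow> 's) \<Rightarrow> 's \<Rightarrow> ('s \<Rightarrow> complex) list \<Rightarrow> nat \<Rightarrow> complex vec" where
  "snapshot \<Gamma> v \<psi>s j = vec (length \<psi>s) (\<lambda>i. (\<psi>s ! i) ((\<Gamma> ^^ (j - 1)) v))"

definition temporal_mean ::
    "('s \<Rightarrow> 's) \<Rightarrow> 's \<Rightarrow> ('s \<Rightarrow> complex) list \<Rightarrow> nat \<Rightarrow> complex vec" where
  "temporal_mean \<Gamma> v \<psi>s n =
     vec (length \<psi>s) (\<lambda>i. (\<Sum>j=1..n+1. snapshot \<Gamma> v \<psi>s j $ i) / of_nat (n + 1))"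

definition X_ms ::
    "('s \<Rightarrow> 's) \<Rightarrow> 's \<Rightarrow> ('s \<Rightarrow> complex) list \<Rightarrow> nat \<Rightarrow> complex mat" where
  "X_ms \<Gamma> v \<psi>s n =
     mat_of_cols (length \<psi>s)
       (map (\<lambda>j. snapshot \<Gamma> v \<psi>s j - temporal_mean \<Gamma> v \<psi>s n) [1..<n+1])"

(* The four Penrose conditions; they have exactly one solution for each complex matrix A. *)
definition is_pinv :: "complex mat \<Rightarrow> complex mat \<Rightarrow> bool" where
  "is_pinv A B \<longleftrightarrow>
     B \<in> carrier_mat (dim_col A) (dim_row A) \<and>
     A * B * A = A \<and> B * A * B = B \<and>
     mat_adjoint (A * B) = A * B \<and> mat_adjoint (B * A) = B * A"

definition pinv :: "complex mat \<Rightarrow> complex mat" where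
  "pinv A = (THE B. is_pinv A B)"

definition dmd_coeffs ::
    "('s \<Rightarrow> 's) \<Rightarrow> 's \<Rightarrow> ('s \<Rightarrow> complex) list \<Rightarrow> nat \<Rightarrow> complex vec" where
  "dmd_coeffs \<Gamma> v \<psi>s n =
     pinv (X_ms \<Gamma> v \<psi>s n) *\<^sub>v (snapshot \<Gamma> v \<psi>s (n + 1) - temporal_mean \<Gamma> v \<psi>s n)"

definition companion_matrix :: "nat \<Rightarrow> complex vec \<Rightarrow> complex mat" where
  "companion_matrix n c =
     mat n n (\<lambda>(i, j). if j = n - 1 then c $ i else if i = j + 1 then 1 else 0)"

definition dmd_eigenvalues ::
    "('s \<Rightarrow> 's) \<Rightarrow> 's \<Rightarrow> ('s \<Rightarrow> complex) list \<Rightarrow> nat \<Rightarrow> complex set" where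
  "dmd_eigenvalues \<Gamma> v \<psi>s n = spectrum (companion_matrix n (dmd_coeffs \<Gamma> v \<psi>s n))"

(* The right-hand side has n elements, so equality of sets also makes all n eigenvalues of the
   companion matrix simple. *)
definition dmd_equivalent_to_dft ::
    "('s \<Rightarrow> 's) \<Rightarrow> 's \<Rightarrow> ('s \<Rightarrow> complex) list \<Rightarrow> nat \<Rightarrow> bool" where
  "dmd_equivalent_to_dft \<Gamma> v \<psi>s n \<longleftrightarrow>
     dmd_eigenvalues \<Gamma> v \<psi>s n = {z. z \<noteq> 1 \<and> z ^ (n + 1) = 1}"

definition full_column_rank :: "complex mat \<Rightarrow> bool" where
  "full_column_rank A \<longleftrightarrow> vec_space.rank (dim_row A) A = dim_col A"

end

theory Submission
  imports Defs
begin

(* One observable suffices. Interpolating at n of the eigenvalues and evaluating at 1 gives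
   weights b_i with sum b_i l_i^j = 1 for j < n, while sum b_i l_i^n = 1 - prod (1 - l_i) differs
   from 1 because 1 is not an eigenvalue. Hence a suitable combination of eigenfunctions takes the
   value 1 on the first n snapshots and another value on the last one, so X_ms is a nonzero
   multiple of the all-ones row. Its rank is 1 < n, but the all-ones vector lies in its row space.
   As the mean-subtracted snapshots sum to zero, c* is the projection of -(1,...,1) to that row
   space, so it is -(1,...,1) and the characteristic polynomial is 1 + z + ... + z^n. *)

section \<open>Lagrange interpolation over a field\<close>

lemma lagrange_interpolation:
  fixes p :: "'a::field poly"
  assumes "finite A" and "degree p < card A"
  shows "(\<Sum>a\<in>A. (\<Prod>k\<in>A - {a}. (x - k) / (a - k)) * poly p a) = poly p x"
proof -
  define L where "L a = (\<Prod>k\<in>A - {a}. Polynomial.smult (1 / (a - k)) [:-k, 1:])" for a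
  define q where "q = (\<Sum>a\<in>A. Polynomial.smult (poly p a) (L a))"
  have L: "poly (L a) y = (\<Prod>k\<in>A - {a}. (y - k) / (a - k))" for a y
    by (simp add: L_def poly_prod diff_divide_distrib)
  have deg_L: "degree (L a) < card A" if "a \<in> A" for a
  proof -
    have "degree (L a) \<le> (\<Sum>k\<in>A - {a}. degree (Polynomial.smult (1 / (a - k)) [:-k, 1:]))"
      unfolding L_def
      by (rule order.trans[OF degree_prod_sum_le]) (simp_all only: assms(1) finite_Diff o_def order.refl)
    also have "\<dots> \<le> (\<Sum>k\<in>A - {a}. 1)"
      by (intro sum_mono order.trans[OF degree_smult_le]) simp
    also have "\<dots> < card A"
      using card_Diff1_less[OF assms(1) that] by simp
    finally show ?thesis .
  qed
  have "q = p"
  proof (rule poly_eqI_degree[of A])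
    fix b assume b: "b \<in> A"
    have delta: "poly (L a) b = (if a = b then 1 else 0)" if "a \<in> A" for a
    proof (cases "a = b")
      case True
      then show ?thesis by (auto simp: L intro!: prod.neutral split: if_splits)
    next
      case False
      then have "(\<Prod>k\<in>A - {a}. (b - k) / (a - k)) = 0"
        using assms(1) b by (intro prod_zero) auto
      then show ?thesis using False by (simp add: L)
    qed
    have "poly q b = (\<Sum>a\<in>A. poly p a * poly (L a) b)"
      by (simp add: q_def poly_sum)
    also have "\<dots> = (\<Sum>a\<in>A. if a = b then poly p a else 0)"
      by (intro sum.cong) (auto simp: delta)
    also have "\<dots> = poly p b"
      using assms(1) b by simp
    finally show "poly q b = poly p b" .
  next
    show "card A > degree q"
      unfolding q_def using assms deg_L
      by (intro degree_sum_less) (auto intro: le_less_trans[OF degree_smult_le])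
  qed fact
  then have "poly p x = (\<Sum>a\<in>A. poly p a * poly (L a) x)"
    by (metis (no_types, lifting) q_def poly_smult poly_sum sum.cong)
  then show ?thesis
    by (simp add: L mult.commute)
qed

text \<open>Subtracting the monic nodal polynomial from the monomial keeps the values at the nodes
  and brings the degree below \<open>card A\<close>, so ordinary interpolation applies. At
  \<open>x = 1\<close> the defect is the product of the \<open>1 - a\<close>.\<close>

lemma lagrange_interpolation_power_card:
  fixes x :: "'a::field"
  assumes "finite A" and "A \<noteq> {}"
  shows "(\<Sum>a\<in>A. (\<Prod>k\<in>A - {a}. (x - k) / (a - k)) * a ^ card A) = x ^ card A - (\<Prod>a\<in>A. x - a)"
proof -
  define Q where "Q = (\<Prod>a\<in>A. [:-a, 1:])"
  define p where "p = monom 1 (card A) - Q"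
  have Q: "poly Q y = (\<Prod>a\<in>A. y - a)" for y
    by (simp add: Q_def poly_prod)
  have deg_Q: "degree Q = card A"
    unfolding Q_def by (subst degree_prod_eq_sum_degree) auto
  have "lead_coeff Q = 1"
    unfolding Q_def by (subst lead_coeff_prod) simp
  then have "coeff p (card A) = 0"
    by (simp add: p_def deg_Q)
  moreover have "degree p \<le> card A"
    unfolding p_def by (intro degree_diff_le) (simp_all add: degree_monom_le deg_Q)
  moreover have "card A > 0"
    using assms by (simp add: card_gt_0_iff)
  \<comment> \<open>Degree exactly \<open>card A\<close> would make the vanishing coefficient the
    leading one, hence \<open>p = 0\<close> and \<open>card A = 0\<close>.\<close>
  ultimately have "degree p < card A"
    by (metis degree_0 le_neq_implies_less leading_coeff_0_iff)
  from lagrange_interpolation[OF assms(1) this, of x]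
  have "(\<Sum>a\<in>A. (\<Prod>k\<in>A - {a}. (x - k) / (a - k)) * poly p a) = poly p x" .
  moreover have "poly p a = a ^ card A" if "a \<in> A" for a
    using that assms(1) by (auto simp: p_def poly_monom Q intro!: prod_zero)
  ultimately show ?thesis
    by (simp add: p_def poly_monom Q)
qed

section \<open>Adjoints and the Moore-Penrose pseudo-inverse\<close>

lemma mat_adjoint_carrier:
  "A \<in> carrier_mat n m \<Longrightarrow> mat_adjoint A \<in> carrier_mat m n"
  by (auto simp: mat_adjoint_def)

lemma index_mat_adjoint:
  "i < dim_col A \<Longrightarrow> j < dim_row A \<Longrightarrow> mat_adjoint A $$ (i, j) = conjugate (A $$ (j, i))"
  by (simp add: mat_adjoint_def mat_of_rows_index)

lemma mat_adjoint_mult: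
  fixes A B :: "'a::conjugatable_field mat"
  assumes "A \<in> carrier_mat n m" and "B \<in> carrier_mat m k"
  shows "mat_adjoint (A * B) = mat_adjoint B * mat_adjoint A"
proof (rule eq_matI)
  note carr = assms mat_adjoint_carrier[OF assms(1)] mat_adjoint_carrier[OF assms(2)]
  fix i j assume "i < dim_row (mat_adjoint B * mat_adjoint A)"
    and "j < dim_col (mat_adjoint B * mat_adjoint A)"
  then have i: "i < k" and j: "j < n" using carr by auto
  have "mat_adjoint (A * B) $$ (i, j) = conjugate (\<Sum>l<m. A $$ (j, l) * B $$ (l, i))"
    using carr i j by (simp add: index_mat_adjoint scalar_prod_def atLeast0LessThan)
  also have "\<dots> = (\<Sum>l<m. conjugate (B $$ (l, i)) * conjugate (A $$ (j, l)))"
    by (simp add: sum_conjugate conjugate_dist_mul mult.commute)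
  also have "\<dots> = (mat_adjoint B * mat_adjoint A) $$ (i, j)"
    using carr i j by (simp add: index_mat_adjoint scalar_prod_def atLeast0LessThan)
  finally show "mat_adjoint (A * B) $$ (i, j) = (mat_adjoint B * mat_adjoint A) $$ (i, j)" .
qed (use assms mat_adjoint_carrier[OF assms(1)] mat_adjoint_carrier[OF assms(2)]
      mat_adjoint_carrier[of "A * B" n k] in auto)

text \<open>\<open>A * B\<close> and \<open>A * C\<close> are both the orthogonal projection onto
  the column space of \<open>A\<close>; \<open>B * A\<close> and \<open>C * A\<close> are both the
  orthogonal projection along its kernel. These two products determine the pseudo-inverse.\<close>

lemma is_pinv_unique:
  assumes "is_pinv A B" and "is_pinv A C"
  shows "B = C"
proof -
  define m n where "m = dim_row A" and "n = dim_col A"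
  have A: "A \<in> carrier_mat m n" by (simp add: m_def n_def)
  have B: "B \<in> carrier_mat n m" and C: "C \<in> carrier_mat n m"
    using assms by (auto simp: is_pinv_def m_def n_def)
  note penB = assms(1)[unfolded is_pinv_def] and penC = assms(2)[unfolded is_pinv_def]
  note AB = mult_carrier_mat[OF A B] and BA = mult_carrier_mat[OF B A]
    and AC = mult_carrier_mat[OF A C] and CA = mult_carrier_mat[OF C A]
  \<comment> \<open>Taking adjoints swaps the two self-adjoint factors, and
    \<open>A * B * A = A\<close> then absorbs \<open>B\<close>.\<close>
  have "A * B = (A * C) * (A * B)"
    using penC by (simp add: assoc_mult_mat[OF AC A B, symmetric])
  then have "A * B = mat_adjoint ((A * C) * (A * B))"
    using penB by simp
  also have "\<dots> = (A * B) * (A * C)"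
    using penB penC by (simp add: mat_adjoint_mult[OF AC AB])
  also have "\<dots> = A * C"
    using penB by (simp add: assoc_mult_mat[OF AB A C, symmetric])
  finally have AB_AC: "A * B = A * C" .
  have "B * A = (B * A) * (C * A)"
    using penC by (simp add: assoc_mult_mat[OF B A CA] assoc_mult_mat[OF A C A, symmetric])
  then have "B * A = mat_adjoint ((B * A) * (C * A))"
    using penB by simp
  also have "\<dots> = (C * A) * (B * A)"
    using penB penC by (simp add: mat_adjoint_mult[OF BA CA])
  also have "\<dots> = C * A"
    using penB by (simp add: assoc_mult_mat[OF C A BA] assoc_mult_mat[OF A B A, symmetric])
  finally have BA_CA: "B * A = C * A" .
  have "B = B * A * B" using penB by simp
  also have "\<dots> = C * (A * B)" by (simp add: BA_CA assoc_mult_mat[OF C A B])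
  also have "\<dots> = C * A * C" by (simp add: AB_AC assoc_mult_mat[OF C A C])
  also have "\<dots> = C" using penC by simp
  finally show ?thesis .
qed

lemma pinv_eqI: "is_pinv A B \<Longrightarrow> pinv A = B"
  unfolding pinv_def by (blast intro: the_equality is_pinv_unique)

text \<open>The candidate is a right inverse, and the product in the other order is the orthogonal
  projection onto the all-ones line. No conjugate of \<open>k\<close> survives, since it cancels
  against the squared norm of the row.\<close>

lemma pinv_constant_row:
  assumes "k \<noteq> 0" and "n > 0"
  shows "pinv (mat 1 n (\<lambda>_. k)) = mat n 1 (\<lambda>_. 1 / (of_nat n * k))"
proof (rule pinv_eqI)
  let ?A = "mat 1 n (\<lambda>_. k)" and ?B = "mat n 1 (\<lambda>_. 1 / (of_nat n * k))"
  have AB: "?A * ?B = 1\<^sub>m 1"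
    using assms by (intro eq_matI) (auto simp: scalar_prod_def)
  have BA: "?B * ?A = mat n n (\<lambda>_. 1 / of_nat n)"
    using assms by (intro eq_matI) (auto simp: scalar_prod_def)
  have "mat_adjoint (?A * ?B) = ?A * ?B"
    unfolding AB using mat_adjoint_carrier[of "1\<^sub>m 1 :: complex mat" 1 1]
    by (intro eq_matI) (auto simp: index_mat_adjoint)
  moreover have "mat_adjoint (?B * ?A) = ?B * ?A"
    unfolding BA using mat_adjoint_carrier[of "mat n n (\<lambda>_. 1 / of_nat n) :: complex mat" n n]
    by (intro eq_matI) (auto simp: index_mat_adjoint conjugate_complex_def)
  moreover have "?B * ?A * ?B = ?B"
    by (subst assoc_mult_mat[of _ n 1 _ n _ 1]) (simp_all only: AB mat_carrier right_mult_one_mat[of _ n])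
  moreover have "?A * ?B * ?A = ?A"
    by (simp only: AB mat_carrier left_mult_one_mat[of _ _ n])
  ultimately show "is_pinv ?A ?B"
    by (simp add: is_pinv_def)
qed

section \<open>Eigenvalues of companion matrices\<close>

lemma eigenvalue_transpose:
  fixes A :: "'a::field mat"
  assumes "A \<in> carrier_mat n n"
  shows "eigenvalue (transpose_mat A) z \<longleftrightarrow> eigenvalue A z"
  using assms by (simp add: eigenvalue_root_char_poly[of _ n])

lemma companion_matrix_carrier: "companion_matrix n c \<in> carrier_mat n n"
  by (simp add: companion_matrix_def)

text \<open>The transpose acts as a shift except in its last entry, which turns the equation for a
  left eigenvector into a first-order recursion with one closing condition.\<close>

lemma companion_matrix_left_mult:
  assumes "v \<in> carrier_vec n" and "i < n"
  shows "(transpose_mat (companion_matrix n c) *\<^sub>v v) $ i =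
    (if i = n - 1 then \<Sum>j<n. c $ j * v $ j else v $ (i + 1))"
proof (cases "i = n - 1")
  case True
  then show ?thesis
    using assms by (simp add: companion_matrix_def scalar_prod_def atLeast0LessThan)
next
  case False
  have "(transpose_mat (companion_matrix n c) *\<^sub>v v) $ i =
      (\<Sum>j<n. (if j = i + 1 then 1 else 0) * v $ j)"
    using assms False by (simp add: companion_matrix_def scalar_prod_def atLeast0LessThan)
  also have "\<dots> = (\<Sum>j<n. if j = i + 1 then v $ j else 0)"
    by (intro sum.cong) auto
  also have "\<dots> = v $ (i + 1)"
    using assms False by simp
  finally show ?thesis using False by simp
qed

(* The left eigenvectors are the multiples of (1, z, ..., z^(n-1)). *)
lemma eigenvalue_companion_matrix:
  assumes "n > 0"
  shows "eigenvalue (companion_matrix n c) z \<longleftrightarrow> z ^ n = (\<Sum>j<n. c $ j * z ^ j)"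
proof -
  let ?T = "transpose_mat (companion_matrix n c)"
  have T: "?T \<in> carrier_mat n n" using companion_matrix_carrier[of n c] by simp
  have "eigenvalue ?T z \<longleftrightarrow> z ^ n = (\<Sum>j<n. c $ j * z ^ j)"
  proof
    assume "eigenvalue ?T z"
    then obtain v where v: "v \<in> carrier_vec n" "v \<noteq> 0\<^sub>v n" "?T *\<^sub>v v = z \<cdot>\<^sub>v v"
      using T unfolding eigenvalue_def eigenvector_def by auto
    have T_v: "z * v $ i = (if i = n - 1 then \<Sum>j<n. c $ j * v $ j else v $ (i + 1))" if "i < n" for i
      using companion_matrix_left_mult[OF v(1) that, of c] v(1,3) that by simp
    have v_pow: "v $ i = v $ 0 * z ^ i" if "i < n" for i
      using that
    proof (induction i)
      case (Suc i)
      then show ?case using T_v[of i] by (simp add: mult.left_commute split: if_splits)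
    qed simp
    \<comment> \<open>All entries are multiples of the first one, so it can be cancelled from the
      closing condition below.\<close>
    have "v $ 0 \<noteq> 0"
    proof
      assume "v $ 0 = 0"
      then have "v = 0\<^sub>v n" using v(1) v_pow by (intro eq_vecI) auto
      then show False using v(2) by simp
    qed
    have "v $ 0 * z ^ n = z * v $ (n - 1)"
      using v_pow[of "n - 1"] assms by (simp add: power_eq_if)
    also have "\<dots> = (\<Sum>j<n. c $ j * v $ j)"
      using T_v[of "n - 1"] assms by simp
    also have "\<dots> = (\<Sum>j<n. c $ j * (v $ 0 * z ^ j))"
      by (intro sum.cong refl arg_cong2[where f = "(*)"] v_pow) simp
    also have "\<dots> = v $ 0 * (\<Sum>j<n. c $ j * z ^ j)"
      by (simp add: sum_distrib_left mult.left_commute)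
    finally show "z ^ n = (\<Sum>j<n. c $ j * z ^ j)" using \<open>v $ 0 \<noteq> 0\<close> by simp
  next
    assume root: "z ^ n = (\<Sum>j<n. c $ j * z ^ j)"
    define v where "v = vec n (\<lambda>i. z ^ i)"
    have v: "v \<in> carrier_vec n" by (simp add: v_def)
    have "v $ 0 \<noteq> 0\<^sub>v n $ 0" using assms by (simp add: v_def)
    then have "v \<noteq> 0\<^sub>v n" by auto
    moreover have "?T *\<^sub>v v = z \<cdot>\<^sub>v v"
    proof (rule eq_vecI)
      fix i assume "i < dim_vec (z \<cdot>\<^sub>v v)"
      then have i: "i < n" by (simp add: v_def)
      have "z * z ^ (n - 1) = z ^ n" using assms by (simp add: power_eq_if)
      then show "(?T *\<^sub>v v) $ i = (z \<cdot>\<^sub>v v) $ i"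
        using i root by (simp add: companion_matrix_left_mult[OF v i]) (auto simp: v_def)
    qed (use T v in auto)
    ultimately show "eigenvalue ?T z"
      using T v unfolding eigenvalue_def eigenvector_def by auto
  qed
  then show ?thesis by (simp add: eigenvalue_transpose[OF companion_matrix_carrier])
qed

text \<open>At \<open>z = 1\<close> the sum is \<open>Suc n\<close>, nonzero in characteristic 0;
  elsewhere the closed form of the geometric sum decides.\<close>

lemma geometric_sum_eq_0_iff:
  fixes z :: "'a::field_char_0"
  shows "(\<Sum>j<Suc n. z ^ j) = 0 \<longleftrightarrow> z \<noteq> 1 \<and> z ^ Suc n = 1"
proof (cases "z = 1")
  case True
  have "(of_nat (Suc n) :: 'a) \<noteq> 0" by (rule of_nat_neq_0)
  with True show ?thesis by simp
next
  case False
  then show ?thesis by (simp add: geometric_sum del: sum.lessThan_Suc)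
qed

lemma spectrum_companion_matrix_minus_ones:
  assumes "n > 0"
  shows "spectrum (companion_matrix n (vec n (\<lambda>_. -1))) = {z. z \<noteq> 1 \<and> z ^ (n + 1) = 1}"
proof -
  have "eigenvalue (companion_matrix n (vec n (\<lambda>_. -1))) z \<longleftrightarrow> (\<Sum>j<Suc n. z ^ j) = 0" for z
    using assms by (simp add: eigenvalue_companion_matrix sum_negf add.commute eq_neg_iff_add_eq_0)
  then show ?thesis
    unfolding geometric_sum_eq_0_iff by (auto simp: spectrum_def)
qed

section \<open>Observables built from Koopman eigenfunctions\<close>

lemma complex_function_space_sum:
  assumes "complex_function_space H" and "finite I" and "\<And>i. i \<in> I \<Longrightarrow> f i \<in> H"
  shows "(\<lambda>x. \<Sum>i\<in>I. c i * f i x) \<in> H"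
  using assms(2,3)
proof (induction I rule: finite_induct)
  case empty
  then show ?case using assms(1) by (simp add: complex_function_space_def)
next
  case (insert i I)
  then have "(\<lambda>x. c i * f i x) \<in> H" and "(\<lambda>x. \<Sum>i\<in>I. c i * f i x) \<in> H"
    using assms(1) by (auto simp: complex_function_space_def)
  then show ?case using insert.hyps assms(1) by (simp add: complex_function_space_def)
qed

lemma koopman_eigenfunction_funpow:
  assumes "koopman_eigenfunction \<Gamma> H l \<phi>"
  shows "\<phi> ((\<Gamma> ^^ k) v) = l ^ k * \<phi> v"
proof (induction k)
  case (Suc k)
  have "\<phi> (\<Gamma> x) = l * \<phi> x" for x
    using assms by (metis comp_apply koopman_def koopman_eigenfunction_def)
  then show ?case using Suc by simp
qed simp

lemma exists_observable_constant_until_last: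
  fixes ev :: "nat \<Rightarrow> complex"
  assumes "complex_function_space H"
    and "finite I" and "I \<noteq> {}"
    and "\<And>i. i \<in> I \<Longrightarrow> koopman_eigenfunction \<Gamma> H (ev i) (\<phi> i)"
    and "inj_on ev I"
    and "\<And>i. i \<in> I \<Longrightarrow> \<phi> i v \<noteq> 0"
    and "1 \<notin> ev ` I"
  obtains \<psi> where "\<psi> \<in> H"
    and "\<And>j. j < card I \<Longrightarrow> \<psi> ((\<Gamma> ^^ j) v) = 1"
    and "\<psi> ((\<Gamma> ^^ card I) v) \<noteq> 1"
proof
  \<comment> \<open>\<open>b a\<close> is the Lagrange basis polynomial of the node
    \<open>a\<close>, evaluated at 1.\<close>
  define b where "b a = (\<Prod>k\<in>ev ` I - {a}. (1 - k) / (a - k))" for a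
  \<comment> \<open>Dividing by \<open>\<phi> i v\<close> normalises each eigenfunction to 1 at the
    initial condition, so that only powers of the eigenvalues remain along the trajectory.\<close>
  define \<psi> where "\<psi> x = (\<Sum>i\<in>I. b (ev i) / \<phi> i v * \<phi> i x)" for x
  have card: "card (ev ` I) = card I" using assms(5) by (rule card_image)
  have val: "\<psi> ((\<Gamma> ^^ j) v) = (\<Sum>a\<in>ev ` I. b a * a ^ j)" for j
    unfolding \<psi>_def sum.reindex[OF assms(5)] o_def
    using assms(6) by (intro sum.cong) (auto simp: koopman_eigenfunction_funpow[OF assms(4)])
  show "\<psi> \<in> H"
    unfolding \<psi>_def using assms(1,2,4)
    by (intro complex_function_space_sum) (auto simp: koopman_eigenfunction_def)
  \<comment> \<open>Interpolation reproduces the monomial of degree \<open>j\<close>, whose value at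
    1 is 1.\<close>
  show "\<psi> ((\<Gamma> ^^ j) v) = 1" if "j < card I" for j
    using lagrange_interpolation[of "ev ` I" "monom 1 j" 1] that assms(2)
    by (simp add: val b_def poly_monom card degree_monom_eq)
  have "\<psi> ((\<Gamma> ^^ card I) v) = 1 - (\<Prod>a\<in>ev ` I. 1 - a)"
    using lagrange_interpolation_power_card[of "ev ` I" 1] assms(2,3) by (simp add: val b_def card)
  moreover have "(\<Prod>a\<in>ev ` I. 1 - a) \<noteq> 0"
    using assms(2,7) by auto
  ultimately show "\<psi> ((\<Gamma> ^^ card I) v) \<noteq> 1" by simp
qed

text \<open>The entries of a single row factor as a constant times a function of the column, so the
  rank is at most 1.\<close>

lemma not_full_column_rank_single_row:
  assumes "A \<in> carrier_mat 1 n" and "n \<ge> 2"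
  shows "\<not> full_column_rank A"
proof -
  have "vec_space.rank 1 A \<le> 1"
    using assms(1) vec_space.rank_le_1_product_entries[OF assms(1), of "\<lambda>_. 1" "\<lambda>c. A $$ (0, c)"]
    by auto
  then show ?thesis using assms by (simp add: full_column_rank_def)
qed

section \<open>The one-observable dictionary\<close>

theorem theorem4p2:
  fixes \<Gamma> :: "real ^ 'p \<Rightarrow> real ^ 'p"
    and H :: "(real ^ 'p \<Rightarrow> complex) set"
    and \<phi> :: "nat \<Rightarrow> real ^ 'p \<Rightarrow> complex"
    and ev :: "nat \<Rightarrow> complex"
    and \<upsilon>\<^sub>1 :: "real ^ 'p"
    and r n :: nat
  assumes "observable_space \<Gamma> H"
    and "\<And>i. i \<in> {1..r} \<Longrightarrow> koopman_eigenfunction \<Gamma> H (ev i) (\<phi> i)"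
    and "inj_on ev {1..r}"
    and "\<And>i. i \<in> {1..r} \<Longrightarrow> \<phi> i \<upsilon>\<^sub>1 \<noteq> 0"
    and "1 \<notin> ev ` {1..r}"
    and "2 \<le> n" and "n \<le> r"
  shows "\<exists>\<psi>s. dictionary H \<psi>s \<and>
           \<not> full_column_rank (X_ms \<Gamma> \<upsilon>\<^sub>1 \<psi>s n) \<and>
           dmd_equivalent_to_dft \<Gamma> \<upsilon>\<^sub>1 \<psi>s n"
proof -
  \<comment> \<open>Exactly \<open>n\<close> eigenfunctions are selected, so that the first value
    other than 1 occurs at the last snapshot.\<close>
  have sub: "{1..n} \<subseteq> {1..r}" using assms(7) by auto
  have space: "complex_function_space H" using assms(1) by (simp add: observable_space_def)
  obtain \<psi> where \<psi>: "\<psi> \<in> H"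
    and one: "\<And>j. j < n \<Longrightarrow> \<psi> ((\<Gamma> ^^ j) \<upsilon>\<^sub>1) = 1"
    and last: "\<psi> ((\<Gamma> ^^ n) \<upsilon>\<^sub>1) \<noteq> 1"
    using exists_observable_constant_until_last[OF space, of "{1..n}" \<Gamma> ev \<phi> \<upsilon>\<^sub>1]
      assms(2,4,5,6) sub inj_on_subset[OF assms(3) sub] by (simp add: subset_iff image_iff) metis
  define w where "w = \<psi> ((\<Gamma> ^^ n) \<upsilon>\<^sub>1)"
  \<comment> \<open>The mean is \<open>(n + w) / (n + 1)\<close>, so \<open>k\<close> is what
    remains of the value 1 after subtracting it.\<close>
  define k where "k = (1 - w) / of_nat (n + 1)"
  have n: "of_nat n + 1 \<noteq> (0 :: complex)"
    by (metis of_nat_Suc of_nat_neq_0 add.commute)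
  have n_pos: "n > 0" using assms(6) by simp
  have k: "k \<noteq> 0" using last n by (simp add: k_def w_def add.commute)
  let ?snap = "snapshot \<Gamma> \<upsilon>\<^sub>1 [\<psi>]" and ?mean = "temporal_mean \<Gamma> \<upsilon>\<^sub>1 [\<psi>] n"
  \<comment> \<open>Snapshot \<open>j\<close> samples the iterate \<open>j - 1\<close>, so
    \<open>w\<close> appears only at \<open>j = n + 1\<close>.\<close>
  have snap: "?snap j = vec 1 (\<lambda>_. if j = n + 1 then w else 1)" if "j \<in> {1..n+1}" for j
    using that one[of "j - 1"] by (auto simp: snapshot_def w_def)
  have "(\<Sum>j=1..n+1. ?snap j $ 0) = (\<Sum>j=1..n+1. if j = n + 1 then w else 1)"
    by (intro sum.cong) (simp_all add: snap)
  also have "\<dots> = of_nat n + w"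
    by simp
  finally have mean: "?mean = vec 1 (\<lambda>_. (of_nat n + w) / of_nat (n + 1))"
    by (intro eq_vecI) (simp_all add: temporal_mean_def)
  have col: "(?snap j - ?mean) $ 0 = k" if "j \<in> {1..n}" for j
    using that n by (simp add: snap mean k_def field_simps)
  have X: "X_ms \<Gamma> \<upsilon>\<^sub>1 [\<psi>] n = mat 1 n (\<lambda>_. k)"
    unfolding X_ms_def mat_of_cols_def by (rule eq_matI) (simp_all add: col del: upt_Suc)
  \<comment> \<open>The \<open>n + 1\<close> centred values sum to zero and the first
    \<open>n\<close> of them equal \<open>k\<close>.\<close>
  have last_col: "?snap (n + 1) - ?mean = vec 1 (\<lambda>_. - of_nat n * k)"
    using n by (intro eq_vecI) (simp_all add: snap mean k_def field_simps)
  \<comment> \<open>Each coefficient is \<open>1 / (n * k)\<close> times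
    \<open>- n * k\<close>.\<close>
  have "dmd_coeffs \<Gamma> \<upsilon>\<^sub>1 [\<psi>] n = vec n (\<lambda>_. -1)"
    unfolding dmd_coeffs_def X last_col pinv_constant_row[OF k n_pos] using k n_pos
    by (intro eq_vecI) (simp_all add: scalar_prod_def)
  then have "dmd_equivalent_to_dft \<Gamma> \<upsilon>\<^sub>1 [\<psi>] n"
    using assms(6)
    by (simp add: dmd_equivalent_to_dft_def dmd_eigenvalues_def spectrum_companion_matrix_minus_ones)
  moreover have "\<not> full_column_rank (X_ms \<Gamma> \<upsilon>\<^sub>1 [\<psi>] n)"
    unfolding X using assms(6) by (intro not_full_column_rank_single_row) auto
  moreover have "dictionary H [\<psi>]"
    using \<psi> by (simp add: dictionary_def)
  ultimately show ?thesis by blast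
qed

end
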